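(* If $S \subseteq \mathbb{N}$ is a nontrivial numerical semigroup with Frobenius number $g = g(S)$, then there is a nilpotent matrix $A \in \mathrm{M}_{g+1}(\mathbb{Q})$ of order $g+1$ such that $S = \mathcal{S}(A)$.
   Context: $\mathbb{N} = \{0,1,2,\ldots\}$. A numerical semigroup is an additive subsemigroup of $\mathbb{N}$ (containing $0$) whose complement in $\mathbb{N}$ is finite. A semigroup in $\mathbb{N}$ is nontrivial if it is not $\{0\}$. The Frobenius number $g(S)$ of a numerical semigroup $S$ is the largest natural number not in $S$. $\mathrm{M}_d(R)$ denotes the set of $d\times d$ matrices with entries in $R$. A nilpotent matrix $A$ has order $k$ if $k$ is the least positive integer with $A^k = 0$. The exponent semigroup of $A \in \mathrm{M}_d(\mathbb{Q})$ is $\mathcal{S}(A) = \{ n \in \mathbb{N} : A^n \in \mathrm{M}_d(\mathbb{Z})\}$, where $A^0 = I$. *)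

theory Defs
  imports Complex_Main "Jordan_Normal_Form.Matrix"
begin

definition numerical_semigroup :: "nat set \<Rightarrow> bool" where
  "numerical_semigroup S \<longleftrightarrow>
     0 \<in> S \<and> (\<forall>m\<in>S. \<forall>n\<in>S. m + n \<in> S) \<and> finite (UNIV - S)"

(* A relation rather than a function: S = UNIV has no gap, hence no Frobenius
   number in this sense. *)
definition is_frobenius_number :: "nat set \<Rightarrow> nat \<Rightarrow> bool" where
  "is_frobenius_number S g \<longleftrightarrow> g \<notin> S \<and> (\<forall>n. n \<notin> S \<longrightarrow> n \<le> g)"

(* Meant for square matrices; the first two conjuncts already say that A is nilpotent. *)
definition nilpotent_of_order :: "'a :: semiring_1 mat \<Rightarrow> nat \<Rightarrow> bool" where
  "nilpotent_of_order A k \<longleftrightarrow>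
     0 < k \<and> A ^\<^sub>m k = 0\<^sub>m (dim_row A) (dim_col A) \<and>
     (\<forall>j. 0 < j \<and> j < k \<longrightarrow> A ^\<^sub>m j \<noteq> 0\<^sub>m (dim_row A) (dim_col A))"

definition exponent_semigroup :: "rat mat \<Rightarrow> nat set" where
  "exponent_semigroup A = {n. elements_mat (A ^\<^sub>m n) \<subseteq> \<int>}"

end

theory Submission
  imports Defs
begin

text \<open>
  Conjugate the nilpotent Jordan block of size \<open>g + 1\<close> by a diagonal matrix with diagonal \<open>x\<close>.
  The \<open>n\<close>-th power has the entries \<open>x (i + n) / x i\<close> on the \<open>n\<close>-th superdiagonal and zeros
  elsewhere, so it is nonzero exactly for \<open>n \<le> g\<close>, and everything reduces to choosing \<open>x\<close> such that
  for \<open>n \<le> g\<close> all these quotients are integers if and only if \<open>n \<in> S\<close>.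

  The choice is \<open>x i = 2\<close> for \<open>i \<in> S\<close> and \<open>x i = 1\<close> otherwise. The only quotient that fails to be an
  integer is \<open>1 / 2\<close>, and it arises exactly when \<open>i \<in> S\<close> and \<open>i + n \<notin> S\<close>. If \<open>n \<in> S\<close> this never
  happens because \<open>S\<close> is closed under addition; if \<open>n \<notin> S\<close> it happens at \<open>i = 0\<close>, because
  \<open>0 \<in> S\<close> and the column \<open>n \<le> g\<close> still lies inside the matrix. Powers beyond \<open>g\<close> vanish, hence
  are integral, and all numbers beyond \<open>g\<close> are in \<open>S\<close>.
\<close>

text \<open>
  This is \<open>D\<^sup>-\<^sup>1 N\<^sup>n D\<close> for the nilpotent Jordan block \<open>N\<close> of size \<open>d\<close> and the diagonal matrix \<open>D\<close>
  with diagonal \<open>x\<close>. Having the exponent \<open>n\<close> as a parameter makes these matrices closed under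
  multiplication.
\<close>
definition scaled_shift_mat :: "(nat \<Rightarrow> 'a :: field) \<Rightarrow> nat \<Rightarrow> nat \<Rightarrow> 'a mat" where
  "scaled_shift_mat x d n = mat d d (\<lambda>(i, j). if j = i + n then x j / x i else 0)"

lemma scaled_shift_mat_carrier [simp]: "scaled_shift_mat x d n \<in> carrier_mat d d"
  by (simp add: scaled_shift_mat_def)

lemma scaled_shift_mat_dim [simp]:
  "dim_row (scaled_shift_mat x d n) = d" "dim_col (scaled_shift_mat x d n) = d"
  by (simp_all add: scaled_shift_mat_def)

lemma scaled_shift_mat_index [simp]:
  "i < d \<Longrightarrow> j < d \<Longrightarrow> scaled_shift_mat x d n $$ (i, j) = (if j = i + n then x j / x i else 0)"
  by (simp add: scaled_shift_mat_def)

text \<open>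
  In row \<open>i\<close> of the left factor only column \<open>i + m\<close> contributes, and the quotients telescope:
  \<open>x (i + m) / x i * (x (i + m + n) / x (i + m)) = x (i + m + n) / x i\<close>.
\<close>
lemma scaled_shift_mat_mult:
  assumes "\<And>i. x i \<noteq> 0"
  shows "scaled_shift_mat x d m * scaled_shift_mat x d n = scaled_shift_mat x d (m + n)"
proof (rule eq_matI)
  fix i j
  assume "i < dim_row (scaled_shift_mat x d (m + n))" "j < dim_col (scaled_shift_mat x d (m + n))"
  then have i: "i < d" and j: "j < d" by simp_all
  have "(scaled_shift_mat x d m * scaled_shift_mat x d n) $$ (i, j) =
      (\<Sum>k = 0..<d. scaled_shift_mat x d m $$ (i, k) * scaled_shift_mat x d n $$ (k, j))"
    using i j by (simp add: scalar_prod_def)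
  also have "\<dots> = (\<Sum>k = 0..<d. if k = i + m then
      (if j = i + m + n then x (i + m) / x i * (x j / x (i + m)) else 0) else 0)"
    using i j by (intro sum.cong) auto
  also have "\<dots> = (if j = i + (m + n) then x j / x i else 0)"
    using j assms by (auto simp: add.assoc)
  finally show "(scaled_shift_mat x d m * scaled_shift_mat x d n) $$ (i, j) =
      scaled_shift_mat x d (m + n) $$ (i, j)"
    using i j by simp
qed simp_all

lemma scaled_shift_mat_power:
  assumes "\<And>i. x i \<noteq> 0"
  shows "scaled_shift_mat x d 1 ^\<^sub>m n = scaled_shift_mat x d n"
proof (induction n)
  case 0
  show ?case using assms by (intro eq_matI) auto
next
  case (Suc n)
  then show ?case using scaled_shift_mat_mult[of x d n 1] assms by simp
qed

lemma scaled_shift_mat_eq_zero_iff: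
  assumes "\<And>i. x i \<noteq> 0"
  shows "scaled_shift_mat x d n = 0\<^sub>m d d \<longleftrightarrow> d \<le> n"
proof
  assume zero: "scaled_shift_mat x d n = 0\<^sub>m d d"
  show "d \<le> n"
  proof (rule ccontr)
    assume "\<not> d \<le> n"
    then have "scaled_shift_mat x d n $$ (0, n) = x n / x 0" by simp
    with zero \<open>\<not> d \<le> n\<close> assms show False by simp
  qed
qed (auto intro!: eq_matI)

lemma nilpotent_of_order_scaled_shift_mat:
  assumes "\<And>i. x i \<noteq> 0" and "0 < d"
  shows "nilpotent_of_order (scaled_shift_mat x d 1) d"
  using assms(2)
  by (simp add: nilpotent_of_order_def scaled_shift_mat_power[OF assms(1)]
      scaled_shift_mat_eq_zero_iff[OF assms(1)] del: One_nat_def)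

lemma scaled_shift_mat_integral_iff:
  "elements_mat (scaled_shift_mat x d n) \<subseteq> \<int> \<longleftrightarrow> (\<forall>i. i + n < d \<longrightarrow> x (i + n) / x i \<in> \<int>)"
proof
  assume integral: "elements_mat (scaled_shift_mat x d n) \<subseteq> \<int>"
  show "\<forall>i. i + n < d \<longrightarrow> x (i + n) / x i \<in> \<int>"
  proof (intro allI impI)
    fix i
    assume "i + n < d"
    then have "scaled_shift_mat x d n $$ (i, i + n) \<in> elements_mat (scaled_shift_mat x d n)"
      by (intro elements_matI[of _ d d i "i + n"]) simp_all
    with integral \<open>i + n < d\<close> show "x (i + n) / x i \<in> \<int>" by auto
  qed
qed (auto dest!: elements_matD)

theorem theorem6p2:
  fixes S :: "nat set" and g :: nat
  assumes "numerical_semigroup S"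
    and "S \<noteq> {0}"
    and "is_frobenius_number S g"
  shows "\<exists>A :: rat mat. A \<in> carrier_mat (g + 1) (g + 1) \<and>
           nilpotent_of_order A (g + 1) \<and> S = exponent_semigroup A"
proof -
  define x :: "nat \<Rightarrow> rat" where "x = (\<lambda>i. if i \<in> S then 2 else 1)"
  define A where "A = scaled_shift_mat x (g + 1) 1"
  have x_nonzero: "x i \<noteq> 0" for i by (simp add: x_def)
  have zero: "0 \<in> S" and add: "\<And>m n. m \<in> S \<Longrightarrow> n \<in> S \<Longrightarrow> m + n \<in> S"
    using assms(1) by (auto simp: numerical_semigroup_def)
  have gap_le: "n \<le> g" if "n \<notin> S" for n
    using assms(3) that by (auto simp: is_frobenius_number_def)
  have half: "(1 / 2 :: rat) \<notin> \<int>"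
  proof
    assume "(1 / 2 :: rat) \<in> \<int>"
    then obtain k where "(1 / 2 :: rat) = of_int k" by (auto elim: Ints_cases)
    then have "of_int (2 * k) = (of_int 1 :: rat)" by simp
    then have "2 * k = 1" by (simp only: of_int_eq_iff)
    then show False by presburger
  qed
  have quotient: "x j / x i \<in> \<int> \<longleftrightarrow> (i \<in> S \<longrightarrow> j \<in> S)" for i j
    using half by (simp add: x_def)
  have "n \<in> S \<longleftrightarrow> n \<in> exponent_semigroup A" for n
  proof -
    have "n \<in> exponent_semigroup A \<longleftrightarrow> (\<forall>i. i + n < g + 1 \<longrightarrow> i \<in> S \<longrightarrow> i + n \<in> S)"
      by (simp add: exponent_semigroup_def A_def scaled_shift_mat_power[OF x_nonzero]
          scaled_shift_mat_integral_iff quotient del: One_nat_def)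
    also have "\<dots> \<longleftrightarrow> n \<in> S"
      using zero add gap_le[of n] by (metis add_0 less_Suc_eq_le Suc_eq_plus1)
    finally show ?thesis by blast
  qed
  then have "S = exponent_semigroup A" by blast
  moreover have "nilpotent_of_order A (g + 1)"
    unfolding A_def using x_nonzero by (intro nilpotent_of_order_scaled_shift_mat) simp_all
  moreover have "A \<in> carrier_mat (g + 1) (g + 1)" by (simp add: A_def)
  ultimately show ?thesis by blast
qed

end
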